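(* Let $n\ge 1$, $N\ge 1$, let $\tau>0$ and $\varepsilon>0$ satisfy $\tau/\varepsilon=1/\sqrt{n}$, and let $V_X\in C^2(\mathbb{R})$ be a real-valued function for each $X\in\mathbb{Z}^n$. Let $\psi:\mathbb{Z}^n\times\mathbb{Z}\to\mathbb{C}^N$ be a solution to the equation $$\big(\psi_X^{T+1}+\psi_X^{T-1}\big)\big(1+\tau^2B_X(|\psi_X^{T+1}|^2,|\psi_X^{T-1}|^2)\big)=\frac1n\sum_{j=1}^n\big(\psi_{X+e_j}^T+\psi_{X-e_j}^T\big),\qquad (X,T)\in\mathbb{Z}^n\times\mathbb{Z},$$ such that $\psi^T\in l^2(\mathbb{Z}^n)$ for all $T\in\mathbb{Z}$. Then the discrete charge $$Q^T=\frac{i}{4\tau}\sum_{X\in\mathbb{Z}^n}\sum_{j=1}^n\Big[\bar\psi_{X+e_j}^T\cdot\psi_X^{T+1}+\bar\psi_{X-e_j}^T\cdot\psi_X^{T+1}-\bar\psi_X^{T+1}\cdot\psi_{X+e_j}^T-\bar\psi_X^{T+1}\cdot\psi_{X-e_j}^T\Big]\varepsilon^n$$ is conserved, that is, $Q^T=Q^{T-1}$ for all $T\in\mathbb{Z}$.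
   Context: $\psi_X^T$ denotes the value of $\psi$ at $(X,T)\in\mathbb{Z}^n\times\mathbb{Z}$, and $\psi^T$ the function $X\mapsto\psi_X^T$ on $\mathbb{Z}^n$. Here $e_1,\dots,e_n$ is the standard basis of $\mathbb{Z}^n$; for $u,v\in\mathbb{C}^N$, $\bar u\cdot v=\sum_{k=1}^N\bar u_kv_k$ and $|u|^2=\bar u\cdot u$; $l^2(\mathbb{Z}^n)$ is the space of square-summable $\mathbb{C}^N$-valued functions on $\mathbb{Z}^n$. For $X\in\mathbb{Z}^n$ and $\lambda,\mu\in\mathbb{R}$, $$B_X(\lambda,\mu)=\frac{V_X(\lambda)-V_X(\mu)}{\lambda-\mu}\ \text{ if }\lambda\ne\mu,\qquad B_X(\lambda,\lambda)=\partial_\lambda V_X(\lambda).$$ *)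

theory Defs
  imports "HOL-Analysis.Analysis"
begin

text \<open>
  The lattice \<open>\<int>\<^sup>n\<close> is \<^typ>\<open>int ^ 'n\<close>, with \<open>n = CARD('n)\<close> and \<open>e\<^sub>j = axis j 1\<close>; the target space
  is \<^typ>\<open>complex ^ 'N\<close>. The value \<open>\<psi>\<^sub>X\<^sup>T\<close> is written \<open>\<psi> X T\<close>.
\<close>

definition C2 :: "(real \<Rightarrow> real) \<Rightarrow> bool" where
  "C2 f \<longleftrightarrow> (\<forall>x. f differentiable (at x)) \<and> (\<forall>x. deriv f differentiable (at x)) \<and>
            continuous_on UNIV (deriv (deriv f))"

text \<open>Conjugate-linear in the first argument.\<close>

definition cdot :: "complex ^ 'N \<Rightarrow> complex ^ 'N \<Rightarrow> complex" where
  "cdot u v = (\<Sum>k\<in>UNIV. cnj (u $ k) * v $ k)"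

text \<open>Hence \<open>|u|\<^sup>2\<close> is the square of the library norm.\<close>

lemma cdot_self: "cdot u u = of_real ((norm u)\<^sup>2)"
proof -
  have "cdot u u = (\<Sum>k\<in>UNIV. of_real ((cmod (u $ k))\<^sup>2))"
    unfolding cdot_def by (intro sum.cong refl) (simp only: complex_norm_square mult.commute)
  also have "\<dots> = of_real ((norm u)\<^sup>2)"
    by (simp add: norm_vec_def L2_set_def sum_nonneg)
  finally show ?thesis .
qed

definition l2 :: "(int ^ 'n \<Rightarrow> complex ^ 'N) \<Rightarrow> bool" where
  "l2 f \<longleftrightarrow> (\<lambda>X. (norm (f X))\<^sup>2) summable_on UNIV"

definition B :: "(int ^ 'n \<Rightarrow> real \<Rightarrow> real) \<Rightarrow> int ^ 'n \<Rightarrow> real \<Rightarrow> real \<Rightarrow> real" where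
  "B V X l m = (if l \<noteq> m then (V X l - V X m) / (l - m) else deriv (V X) l)"

definition solution ::
  "real \<Rightarrow> (int ^ 'n \<Rightarrow> real \<Rightarrow> real) \<Rightarrow> (int ^ 'n \<Rightarrow> int \<Rightarrow> complex ^ 'N) \<Rightarrow> bool" where
  "solution \<tau> V \<psi> \<longleftrightarrow>
    (\<forall>X T. (1 + \<tau>\<^sup>2 * B V X ((norm (\<psi> X (T + 1)))\<^sup>2) ((norm (\<psi> X (T - 1)))\<^sup>2)) *\<^sub>R
             (\<psi> X (T + 1) + \<psi> X (T - 1))
         = (1 / real CARD('n)) *\<^sub>R (\<Sum>j\<in>UNIV. \<psi> (X + axis j 1) T + \<psi> (X - axis j 1) T))"

text \<open>
  The lattice sum is unordered. It converges absolutely when every time slice of \<open>\<psi>\<close> is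
  square-summable, by the Cauchy-Schwarz inequality.
\<close>

definition charge :: "real \<Rightarrow> real \<Rightarrow> (int ^ 'n \<Rightarrow> int \<Rightarrow> complex ^ 'N) \<Rightarrow> int \<Rightarrow> complex" where
  "charge \<tau> \<epsilon> \<psi> T =
    \<i> / (4 * of_real \<tau>) *
    (\<Sum>\<^sub>\<infinity>X\<in>UNIV. \<Sum>j\<in>UNIV.
       (cdot (\<psi> (X + axis j 1) T) (\<psi> X (T + 1)) + cdot (\<psi> (X - axis j 1) T) (\<psi> X (T + 1))
        - cdot (\<psi> X (T + 1)) (\<psi> (X + axis j 1) T) - cdot (\<psi> X (T + 1)) (\<psi> (X - axis j 1) T))
       * of_real (\<epsilon> ^ CARD('n)))"

end

theory Submission
  imports Defs
begin

text \<open>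
  The charge density at time \<open>T\<close> is the commutator \<open>\<langle>s, a\<rangle> - \<langle>a, s\<rangle>\<close>, where \<open>s\<close> is the sum of
  \<open>\<psi>\<^sup>T\<close> over the neighbours of \<open>X\<close> and \<open>a = \<psi>\<^sub>X\<^sup>T\<^sup>+\<^sup>1\<close>. Summation by parts (square summability allows
  shifting the lattice variable) turns the density at time \<open>T - 1\<close> into \<open>\<langle>b, s\<rangle> - \<langle>s, b\<rangle>\<close> with
  \<open>b = \<psi>\<^sub>X\<^sup>T\<^sup>-\<^sup>1\<close>. The two differ by the commutator of \<open>s\<close> with \<open>a + b\<close>, which vanishes because by the
  equation \<open>s\<close> is a real multiple of \<open>a + b\<close>.
\<close>

definition comm :: "complex ^ 'N \<Rightarrow> complex ^ 'N \<Rightarrow> complex" where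
  "comm u v = cdot u v - cdot v u"

lemma comm_minus_swap: "comm v u = - comm u v"
  by (simp add: comm_def)

lemma cdot_add_left: "cdot (u + v) w = cdot u w + cdot v w"
  by (simp add: cdot_def algebra_simps sum.distrib)

lemma cdot_add_right: "cdot w (u + v) = cdot w u + cdot w v"
  by (simp add: cdot_def algebra_simps sum.distrib)

lemma comm_add_left: "comm (u + v) w = comm u w + comm v w"
  by (simp add: comm_def cdot_add_left cdot_add_right)

lemma comm_add_right: "comm w (u + v) = comm w u + comm w v"
  by (simp add: comm_def cdot_add_left cdot_add_right)

text \<open>\<open>cdot w u\<close> is the conjugate of \<open>cdot u w\<close>, so
  \<open>comm u w\<close> is 2i times the imaginary part of \<open>cdot u w\<close>. A real factor
  comes out of both terms alike; a complex one would come out conjugated from one of them.\<close>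

lemma comm_scaleR_left: "comm (c *\<^sub>R u) w = c *\<^sub>R comm u w"
  by (simp add: comm_def cdot_def scaleR_sum_right algebra_simps)

lemma comm_sum_left: "comm (\<Sum>j\<in>A. f j) w = (\<Sum>j\<in>A. comm (f j) w)"
proof (induction A rule: infinite_finite_induct)
  case (insert x F)
  then show ?case by (simp add: comm_add_left)
qed (simp_all add: comm_def cdot_def)

lemma norm_cdot_le: "norm (cdot u v) \<le> norm u * norm v"
proof -
  have "norm (cdot u v) \<le> (\<Sum>k\<in>UNIV. \<bar>norm (u $ k)\<bar> * \<bar>norm (v $ k)\<bar>)"
    unfolding cdot_def by (rule order_trans[OF norm_sum]) (simp add: norm_mult)
  also have "\<dots> \<le> norm u * norm v"
    unfolding norm_vec_def by (rule L2_set_mult_ineq)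
  finally show ?thesis .
qed

text \<open>Cauchy-Schwarz followed by 2xy \<le> x^2 + y^2. Bounding by a sum of squares rather than
  a product makes \<open>l2\<close> directly usable as a summable majorant.\<close>

lemma norm_comm_le: "norm (comm u v) \<le> (norm u)\<^sup>2 + (norm v)\<^sup>2"
proof -
  have "norm (comm u v) \<le> norm (cdot u v) + norm (cdot v u)"
    unfolding comm_def by (rule norm_triangle_ineq4)
  also have "\<dots> \<le> 2 * norm u * norm v"
    using norm_cdot_le[of u v] norm_cdot_le[of v u] by (simp add: mult.commute mult.left_commute)
  also have "\<dots> \<le> (norm u)\<^sup>2 + (norm v)\<^sup>2"
    by (rule sum_squares_bound)
  finally show ?thesis .
qed

lemma bij_lattice_shift: "bij_betw (\<lambda>X :: 'a :: group_add. X + a) UNIV UNIV"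
  by (rule bij_betwI[where g = "\<lambda>X. X - a"]) auto

lemma l2_shift:
  assumes "l2 f"
  shows "l2 (\<lambda>X. f (X + a))"
  using assms summable_on_reindex_bij_betw[OF bij_lattice_shift, of "\<lambda>X. (norm (f X))\<^sup>2" a]
  by (simp add: l2_def)

lemma summable_comm:
  assumes "l2 f" and "l2 g"
  shows "(\<lambda>X. comm (f X) (g X)) summable_on UNIV"
proof (rule Infinite_Sum.abs_summable_summable, rule Infinite_Sum.abs_summable_on_comparison_test')
  show "(\<lambda>X. (norm (f X))\<^sup>2 + (norm (g X))\<^sup>2) summable_on UNIV"
    using assms unfolding l2_def by (rule summable_on_add)
qed (rule norm_comm_le)

text \<open>Summation by parts for one translation: reindex by the bijection X -> X + a.\<close>

lemma infsum_comm_shift: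
  fixes a :: "'a :: group_add"
  shows "(\<Sum>\<^sub>\<infinity>X\<in>UNIV. comm (f (X + a)) (g X)) = (\<Sum>\<^sub>\<infinity>X\<in>UNIV. comm (f X) (g (X - a)))"
  using infsum_reindex_bij_betw[OF bij_lattice_shift, of "\<lambda>X. comm (f X) (g (X - a))" a]
  by simp

definition nbr_sum :: "(int ^ 'n \<Rightarrow> complex ^ 'N) \<Rightarrow> int ^ 'n \<Rightarrow> complex ^ 'N" where
  "nbr_sum f X = (\<Sum>j\<in>UNIV. f (X + axis j 1) + f (X - axis j 1))"

lemma has_sum_finite_sum:
  fixes f :: "'i \<Rightarrow> 'a \<Rightarrow> 'b :: topological_comm_monoid_add"
  assumes "\<And>i. i \<in> I \<Longrightarrow> (f i has_sum s i) A"
  shows "((\<lambda>x. \<Sum>i\<in>I. f i x) has_sum (\<Sum>i\<in>I. s i)) A"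
  using assms
  by (induction I rule: infinite_finite_induct) (auto intro: has_sum_add)

text \<open>Separates the 2n translates so that each can be reindexed by its own shift; splitting
  the infinite sum is justified because every translate of \<open>f\<close> is again in
  \<open>l2\<close>.\<close>

lemma infsum_comm_nbr_sum:
  assumes f: "l2 f" and g: "l2 g"
  shows "(\<Sum>\<^sub>\<infinity>X\<in>UNIV. comm (nbr_sum f X) (g X)) =
    (\<Sum>j\<in>UNIV. (\<Sum>\<^sub>\<infinity>X\<in>UNIV. comm (f (X + axis j 1)) (g X)) +
               (\<Sum>\<^sub>\<infinity>X\<in>UNIV. comm (f (X - axis j 1)) (g X)))"
proof -
  have p: "(\<lambda>X. comm (f (X + a)) (g X)) summable_on UNIV" for a
    using summable_comm[OF l2_shift[OF f] g] .
  have m: "(\<lambda>X. comm (f (X - a)) (g X)) summable_on UNIV" for a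
    using p[of "- a"] by simp
  show ?thesis
    unfolding nbr_sum_def comm_sum_left comm_add_left
    by (intro infsumI has_sum_finite_sum has_sum_add has_sum_infsum p m)
qed

text \<open>The set of neighbour directions is invariant under negation, so moving the shifts to the
  other factor gives \<open>nbr_sum\<close> again; the sign is the antisymmetry of
  \<open>comm\<close>.\<close>

lemma infsum_comm_nbr_sum_swap:
  assumes f: "l2 f" and g: "l2 g"
  shows "(\<Sum>\<^sub>\<infinity>X\<in>UNIV. comm (nbr_sum f X) (g X)) = - (\<Sum>\<^sub>\<infinity>X\<in>UNIV. comm (nbr_sum g X) (f X))"
proof -
  have p: "(\<Sum>\<^sub>\<infinity>X\<in>UNIV. comm (f (X + a)) (g X)) = - (\<Sum>\<^sub>\<infinity>X\<in>UNIV. comm (g (X - a)) (f X))" for a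
    unfolding infsum_comm_shift
    by (subst comm_minus_swap) (rule infsum_uminus)
  have m: "(\<Sum>\<^sub>\<infinity>X\<in>UNIV. comm (f (X - a)) (g X)) = - (\<Sum>\<^sub>\<infinity>X\<in>UNIV. comm (g (X + a)) (f X))" for a
    using p[of "- a"] by simp
  show ?thesis
    unfolding infsum_comm_nbr_sum[OF f g] infsum_comm_nbr_sum[OF g f] p m
    \<comment> \<open>The forward and backward terms have traded places, so only their order within
      each direction differs.\<close>
    by (simp add: sum_negf[symmetric] algebra_simps)
qed

lemma charge_eq_infsum_comm:
  "charge \<tau> \<epsilon> \<psi> T = \<i> / (4 * of_real \<tau>) *
    ((\<Sum>\<^sub>\<infinity>X\<in>UNIV. comm (nbr_sum (\<lambda>X. \<psi> X T) X) (\<psi> X (T + 1))) * of_real (\<epsilon> ^ CARD('n)))"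
  for \<psi> :: "int ^ 'n \<Rightarrow> int \<Rightarrow> complex ^ 'N"
  unfolding charge_def infsum_cmult_left'[symmetric] nbr_sum_def comm_sum_left sum_distrib_right
  by (simp add: comm_def cdot_add_left cdot_add_right algebra_simps)

text \<open>The point is that c is real: it is n times the coefficient in the equation, which is
  real because \<open>V\<close> is real-valued.\<close>

lemma solution_nbr_sum:
  fixes \<psi> :: "int ^ 'n \<Rightarrow> int \<Rightarrow> complex ^ 'N"
  assumes "solution \<tau> V \<psi>"
  obtains c where "nbr_sum (\<lambda>X. \<psi> X T) X = c *\<^sub>R (\<psi> X (T + 1) + \<psi> X (T - 1))"
proof
  let ?k = "1 + \<tau>\<^sup>2 * B V X ((norm (\<psi> X (T + 1)))\<^sup>2) ((norm (\<psi> X (T - 1)))\<^sup>2)"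
  have "?k *\<^sub>R (\<psi> X (T + 1) + \<psi> X (T - 1)) = (1 / real CARD('n)) *\<^sub>R nbr_sum (\<lambda>X. \<psi> X T) X"
    using assms by (simp add: solution_def nbr_sum_def)
  then have "real CARD('n) *\<^sub>R (?k *\<^sub>R (\<psi> X (T + 1) + \<psi> X (T - 1))) = nbr_sum (\<lambda>X. \<psi> X T) X"
    by simp
  then show "nbr_sum (\<lambda>X. \<psi> X T) X = (real CARD('n) * ?k) *\<^sub>R (\<psi> X (T + 1) + \<psi> X (T - 1))"
    by simp
qed

lemma solution_comm_nbr_sum:
  assumes "solution \<tau> V \<psi>"
  shows "comm (nbr_sum (\<lambda>X. \<psi> X T) X) (\<psi> X (T + 1)) =
    - comm (nbr_sum (\<lambda>X. \<psi> X T) X) (\<psi> X (T - 1))"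
proof -
  obtain c where c: "nbr_sum (\<lambda>X. \<psi> X T) X = c *\<^sub>R (\<psi> X (T + 1) + \<psi> X (T - 1))"
    using solution_nbr_sum[OF assms] .
  have "comm (nbr_sum (\<lambda>X. \<psi> X T) X) (\<psi> X (T + 1) + \<psi> X (T - 1)) = 0"
    \<comment> \<open>What remains is the commutator of a vector with itself.\<close>
    unfolding c by (simp only: comm_scaleR_left) (simp add: comm_def)
  then show ?thesis
    by (simp add: comm_add_right add_eq_0_iff2)
qed

theorem theorem2p17:
  fixes \<tau> \<epsilon> :: real
    and V :: "int ^ 'n \<Rightarrow> real \<Rightarrow> real"
    and \<psi> :: "int ^ 'n \<Rightarrow> int \<Rightarrow> complex ^ 'N"
  assumes "\<tau> > 0" and "\<epsilon> > 0" and "\<tau> / \<epsilon> = 1 / sqrt (real CARD('n))"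
    and "\<And>X. C2 (V X)"
    and "solution \<tau> V \<psi>"
    and "\<And>T. l2 (\<lambda>X. \<psi> X T)"
  shows "\<forall>T. charge \<tau> \<epsilon> \<psi> T = charge \<tau> \<epsilon> \<psi> (T - 1)"
proof
  fix T
  let ?s = "nbr_sum (\<lambda>X. \<psi> X T)"
  have "(\<Sum>\<^sub>\<infinity>X\<in>UNIV. comm (?s X) (\<psi> X (T + 1))) = - (\<Sum>\<^sub>\<infinity>X\<in>UNIV. comm (?s X) (\<psi> X (T - 1)))"
    unfolding solution_comm_nbr_sum[OF assms(5)] by (rule infsum_uminus)
  also have "\<dots> = (\<Sum>\<^sub>\<infinity>X\<in>UNIV. comm (nbr_sum (\<lambda>X. \<psi> X (T - 1)) X) (\<psi> X T))"
    \<comment> \<open>The result is the density of the charge at time T - 1, since (T - 1) + 1 =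
      T.\<close>
    by (rule infsum_comm_nbr_sum_swap[OF assms(6) assms(6), symmetric])
  finally show "charge \<tau> \<epsilon> \<psi> T = charge \<tau> \<epsilon> \<psi> (T - 1)"
    by (simp add: charge_eq_infsum_comm)
qed

end
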